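(* Let $(X,\to,{}^*,1)$ be an implicative-ortholattice and let $(X',\perp)$, $X'=X\setminus\{0\}$, be the associated orthogonality space. The following are equivalent: (a) $(X',\perp)$ is a Dacey space; (b) every two orthogonal elements of $\mathcal{CL}(X',\perp)$ are contained in an implicative-Boolean subalgebra of $\mathcal{CL}(X',\perp)$.
   Context: A BE algebra is an algebra $(X,\to,1)$ such that for all $x,y,z\in X$: $x\to x=1$; $x\to 1=1$; $1\to x=x$; $x\to(y\to z)=y\to(x\to z)$. It carries the relation $x\le y$ iff $x\to y=1$. It is bounded if there is $0\in X$ with $0\le x$ for all $x\in X$; then $x^*:=x\to 0$ (so $0=1^*$) and the algebra is written $(X,\to,{}^*,1)$. It is involutive if $x^{**}=x$ for all $x$, and implicative if $(x\to y)\to x=x$ for all $x,y$. An implicative-ortholattice is an implicative involutive (bounded) BE algebra. Put $x\wedge_Q y:=((x^*\to y^* )\to y^* )^*$. An implicative-orthomodular lattice is an implicative-ortholattice with $x\wedge_Q(y\to x)=x$ for all $x,y$. An implicative-Boolean algebra is an implicative-ortholattice with $(y^*\to x)\to y=x\to y$ for all $x,y$. An implicative-Boolean subalgebra of an implicative-ortholattice is a subset containing $0,1$ and closed under $\to$ (hence under $^*$) which is an implicative-Boolean algebra under the restricted operations. In any implicative-ortholattice, elements $x,y$ are orthogonal, $x\perp y$, iff $x^*=x\to y$. The associated orthogonality space of an implicative-ortholattice $X$ is $X'=X\setminus\{0\}$ with the (symmetric, irreflexive) relation $\perp$ restricted to $X'$. For $A\subseteq X'$, $A^\perp=\{x\in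 X'\mid x\perp a\text{ for all }a\in A\}$; $A$ is orthoclosed if $A=A^{\perp\perp}$; $\mathcal{CL}(X',\perp)$ is the set of all orthoclosed subsets of $X'$. With $A\to B:=(A\cap B^\perp)^\perp$, $A^*:=A\to\emptyset=A^\perp$ and top element $X'$, $\mathcal{CL}(X',\perp)$ is an implicative-ortholattice (with bottom $\emptyset$). $(X',\perp)$ is a Dacey space if $\mathcal{CL}(X',\perp)$ is an implicative-orthomodular lattice. *)

theory Defs
  imports Main
begin

section \<open>Implicative-ortholattices\<close>

text \<open>
  All algebras live on an explicit carrier set \<open>X\<close>, because the second algebra of interest has
  a set of sets as its carrier.  The values of \<open>imp\<close> outside \<open>X\<close> are irrelevant.
  The least element \<open>zero\<close> is a parameter and the star operation is derived from it.
\<close>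

definition star :: "('a \<Rightarrow> 'a \<Rightarrow> 'a) \<Rightarrow> 'a \<Rightarrow> 'a \<Rightarrow> 'a" where
  "star imp zero x = imp x zero"

definition meetQ :: "('a \<Rightarrow> 'a \<Rightarrow> 'a) \<Rightarrow> 'a \<Rightarrow> 'a \<Rightarrow> 'a \<Rightarrow> 'a" where
  "meetQ imp zero x y =
     star imp zero (imp (imp (star imp zero x) (star imp zero y)) (star imp zero y))"

definition orth :: "('a \<Rightarrow> 'a \<Rightarrow> 'a) \<Rightarrow> 'a \<Rightarrow> 'a \<Rightarrow> 'a \<Rightarrow> bool" where
  "orth imp zero x y \<longleftrightarrow> star imp zero x = imp x y"

locale be_algebra =
  fixes X :: "'a set" and imp :: "'a \<Rightarrow> 'a \<Rightarrow> 'a" and one :: 'a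
  assumes one_closed: "one \<in> X"
    and imp_closed: "\<lbrakk>x \<in> X; y \<in> X\<rbrakk> \<Longrightarrow> imp x y \<in> X"
    and imp_self: "x \<in> X \<Longrightarrow> imp x x = one"
    and imp_one: "x \<in> X \<Longrightarrow> imp x one = one"
    and one_imp: "x \<in> X \<Longrightarrow> imp one x = x"
    and imp_exchange: "\<lbrakk>x \<in> X; y \<in> X; z \<in> X\<rbrakk> \<Longrightarrow> imp x (imp y z) = imp y (imp x z)"

text \<open>The axiom \<open>zero_least\<close> reads \<open>zero \<le> x\<close>, where \<open>x \<le> y\<close> means \<open>imp x y = one\<close>.\<close>

locale bounded_be_algebra = be_algebra X imp one
  for X :: "'a set" and imp :: "'a \<Rightarrow> 'a \<Rightarrow> 'a" and one :: 'a +
  fixes zero :: 'a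
  assumes zero_closed: "zero \<in> X"
    and zero_least: "x \<in> X \<Longrightarrow> imp zero x = one"

locale implicative_ortholattice = bounded_be_algebra +
  assumes involutive: "x \<in> X \<Longrightarrow> star imp zero (star imp zero x) = x"
    and implicative: "\<lbrakk>x \<in> X; y \<in> X\<rbrakk> \<Longrightarrow> imp (imp x y) x = x"

locale implicative_orthomodular_lattice = implicative_ortholattice +
  assumes orthomodular: "\<lbrakk>x \<in> X; y \<in> X\<rbrakk> \<Longrightarrow> meetQ imp zero x (imp y x) = x"

locale implicative_boolean_algebra = implicative_ortholattice +
  assumes boolean: "\<lbrakk>x \<in> X; y \<in> X\<rbrakk> \<Longrightarrow> imp (imp (star imp zero y) x) y = imp x y"

text \<open>Closure of \<open>S\<close> under \<open>imp\<close> is part of \<open>implicative_boolean_algebra\<close>, as are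
  \<open>one \<in> S\<close> and \<open>zero \<in> S\<close>.\<close>

definition implicative_boolean_subalgebra ::
  "'a set \<Rightarrow> 'a set \<Rightarrow> ('a \<Rightarrow> 'a \<Rightarrow> 'a) \<Rightarrow> 'a \<Rightarrow> 'a \<Rightarrow> bool" where
  "implicative_boolean_subalgebra S X imp one zero \<longleftrightarrow>
     S \<subseteq> X \<and> implicative_boolean_algebra S imp one zero"


section \<open>Orthogonality spaces\<close>

locale orthogonality_space =
  fixes X :: "'a set" and perp :: "'a \<Rightarrow> 'a \<Rightarrow> bool"
  assumes perp_sym: "\<lbrakk>x \<in> X; y \<in> X; perp x y\<rbrakk> \<Longrightarrow> perp y x"
    and perp_irrefl: "x \<in> X \<Longrightarrow> \<not> perp x x"

definition orthocompl :: "'a set \<Rightarrow> ('a \<Rightarrow> 'a \<Rightarrow> bool) \<Rightarrow> 'a set \<Rightarrow> 'a set" where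
  "orthocompl X perp A = {x \<in> X. \<forall>a\<in>A. perp x a}"

definition orthoclosed :: "'a set \<Rightarrow> ('a \<Rightarrow> 'a \<Rightarrow> bool) \<Rightarrow> 'a set \<Rightarrow> bool" where
  "orthoclosed X perp A \<longleftrightarrow> A \<subseteq> X \<and> A = orthocompl X perp (orthocompl X perp A)"

definition CL :: "'a set \<Rightarrow> ('a \<Rightarrow> 'a \<Rightarrow> bool) \<Rightarrow> 'a set set" where
  "CL X perp = {A. orthoclosed X perp A}"

definition CL_imp :: "'a set \<Rightarrow> ('a \<Rightarrow> 'a \<Rightarrow> bool) \<Rightarrow> 'a set \<Rightarrow> 'a set \<Rightarrow> 'a set" where
  "CL_imp X perp A B = orthocompl X perp (A \<inter> orthocompl X perp B)"

locale dacey_space = orthogonality_space X perp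
  for X :: "'a set" and perp :: "'a \<Rightarrow> 'a \<Rightarrow> bool" +
  assumes CL_orthomodular:
    "implicative_orthomodular_lattice (CL X perp) (CL_imp X perp) X {}"


section \<open>Well-definedness of the constructions\<close>

lemma (in implicative_ortholattice) orth_sym:
  assumes x: "x \<in> X" and y: "y \<in> X" and o: "orth imp zero x y"
  shows "orth imp zero y x"
proof -
  let ?s = "star imp zero"
  have closed: "?s u \<in> X" if "u \<in> X" for u
    using that by (simp add: star_def imp_closed zero_closed)
  have contra: "imp (?s v) (?s u) = imp u v" if "u \<in> X" "v \<in> X" for u v
  proof -
    have "imp (?s v) (imp u zero) = imp u (imp (?s v) zero)"
      using that closed zero_closed imp_exchange by blast
    also have "imp (?s v) zero = v"
      using involutive[OF that(2)] by (simp add: star_def)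
    finally show ?thesis by (simp add: star_def)
  qed
  have "imp (?s y) (?s x) = ?s x"
    using contra[OF x y] o by (simp add: orth_def)
  then have "imp (?s x) (?s y) = ?s y"
    using implicative[OF closed[OF y] closed[OF x]] by simp
  then show ?thesis
    using contra[OF y x] by (simp add: orth_def)
qed

lemma (in implicative_ortholattice) associated_orthogonality_space:
  "orthogonality_space (X - {zero}) (orth imp zero)"
proof
  fix x y
  assume "x \<in> X - {zero}" "y \<in> X - {zero}" "orth imp zero x y"
  then show "orth imp zero y x" using orth_sym by blast
next
  fix x
  assume x: "x \<in> X - {zero}"
  show "\<not> orth imp zero x x"
  proof
    assume "orth imp zero x x"
    then have "star imp zero x = one" using x by (simp add: orth_def imp_self)
    then have "x = star imp zero one" using involutive[of x] x by simp
    then show False using x one_imp zero_closed by (simp add: star_def)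
  qed
qed

lemma (in orthogonality_space) CL_implicative_ortholattice:
  "implicative_ortholattice (CL X perp) (CL_imp X perp) X {}"
proof -
  let ?c = "orthocompl X perp"
  have sub: "?c A \<subseteq> X" for A by (auto simp: orthocompl_def)
  have anti: "?c B \<subseteq> ?c A" if "A \<subseteq> B" for A B
    using that by (auto simp: orthocompl_def)
  have inc: "A \<subseteq> ?c (?c A)" if "A \<subseteq> X" for A
    using that perp_sym by (auto simp: orthocompl_def)
  have triple: "?c (?c (?c A)) = ?c A" if "A \<subseteq> X" for A
    using anti[OF inc[OF that]] inc[OF sub] by (rule equalityI)
  have empty: "?c {} = X" by (simp add: orthocompl_def)
  have full: "?c X = {}" using perp_irrefl by (auto simp: orthocompl_def)
  have disj: "A \<inter> ?c A = {}" if "A \<subseteq> X" for A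
    using perp_irrefl that by (auto simp: orthocompl_def)
  have CLD: "A \<subseteq> X" "?c (?c A) = A" if "A \<in> CL X perp" for A
    using that unfolding CL_def orthoclosed_def by simp_all
  have CLI: "?c A \<in> CL X perp" if "A \<subseteq> X" for A
    using sub triple[OF that] by (simp add: CL_def orthoclosed_def)
  have int: "?c (?c (A \<inter> B)) = A \<inter> B" if A: "A \<in> CL X perp" and B: "B \<in> CL X perp" for A B
  proof
    have "A \<inter> B \<subseteq> X" using CLD(1)[OF A] by (rule le_infI1)
    then show "A \<inter> B \<subseteq> ?c (?c (A \<inter> B))" by (rule inc)
    have "?c (?c (A \<inter> B)) \<subseteq> ?c (?c A)" by (rule anti, rule anti, rule Int_lower1)
    moreover have "?c (?c (A \<inter> B)) \<subseteq> ?c (?c B)" by (rule anti, rule anti, rule Int_lower2)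
    ultimately show "?c (?c (A \<inter> B)) \<subseteq> A \<inter> B"
      unfolding CLD(2)[OF A] CLD(2)[OF B] by (rule Int_greatest)
  qed
  have star: "star (CL_imp X perp) {} A = ?c A" if "A \<subseteq> X" for A
    using that by (simp add: star_def CL_imp_def empty Int_absorb2)
  show ?thesis
  proof
    show one: "X \<in> CL X perp" using CLI[of "{}"] empty by simp
    show zero: "{} \<in> CL X perp" using CLI[of X] full by simp
    fix A assume A: "A \<in> CL X perp"
    show "CL_imp X perp A A = X"
      by (simp add: CL_imp_def disj[OF CLD(1)[OF A]] empty)
    show "CL_imp X perp A X = X" by (simp add: CL_imp_def full empty)
    show "CL_imp X perp X A = A"
      using CLD[OF A] sub[of A] by (simp add: CL_imp_def Int_absorb1)
    show "CL_imp X perp {} A = X" by (simp add: CL_imp_def empty)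
    show "star (CL_imp X perp) {} (star (CL_imp X perp) {} A) = A"
      using CLD[OF A] sub by (simp add: star)
    fix B assume B: "B \<in> CL X perp"
    show "CL_imp X perp A B \<in> CL X perp"
      unfolding CL_imp_def using CLD(1)[OF A] by (intro CLI) auto
    have "?c A \<subseteq> ?c (A \<inter> ?c B)" by (rule anti) blast
    then show "CL_imp X perp (CL_imp X perp A B) A = A"
      using CLD[OF A] by (simp add: CL_imp_def Int_absorb1)
    fix C assume C: "C \<in> CL X perp"
    have nC: "?c C \<in> CL X perp" using CLI CLD(1)[OF C] .
    show "CL_imp X perp A (CL_imp X perp B C) = CL_imp X perp B (CL_imp X perp A C)"
      using int[OF B nC] int[OF A nC] by (simp add: CL_imp_def Int_left_commute)
  qed
qed

end

theory Submission
  imports Defs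
begin

text \<open>
  The equivalence is a general fact about implicative-ortholattices, applied to the lattice of
  orthoclosed sets: such a lattice is orthomodular iff any two orthogonal elements lie in a common
  implicative-Boolean subalgebra (\<open>orthomodular_iff_orthogonal_pairs_boolean\<close>).

  In lattice terms \<open>imp x y\<close> is \<open>(x \<and> y\<^sup>*)\<^sup>*\<close>, orthogonality of \<open>x\<close> and \<open>y\<close> is \<open>x \<le> y\<^sup>*\<close>, and the
  orthomodular law at \<open>x, y\<close> says \<open>(x \<or> w) \<and> w\<^sup>* = x\<close> for \<open>w = y \<and> x\<^sup>*\<close>.  This law mentions only
  the orthogonal pair \<open>x, w\<close>, and the Boolean law for that pair is \<open>(x \<or> w) \<and> w\<^sup>* = x \<and> w\<^sup>*\<close>, which
  is \<open>x\<close>; so a Boolean subalgebra around each orthogonal pair forces orthomodularity.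

  Conversely, for orthogonal \<open>a, b\<close> put \<open>c = (a \<or> b)\<^sup>*\<close>.  Orthomodularity gives \<open>a \<or> c = b\<^sup>*\<close> and
  \<open>b \<or> c = a\<^sup>*\<close>, so \<open>a, b, c\<close> are pairwise orthogonal and the join of any two is the complement of
  the third.  This makes the situation symmetric in \<open>a, b, c\<close> and determines \<open>imp\<close> on
  \<open>{0, 1, a, b, c, a\<^sup>*, b\<^sup>*, c\<^sup>*}\<close> by the truth table of the Boolean algebra with atoms \<open>a, b, c\<close>
  (some of which may be \<open>0\<close>).
\<close>

context implicative_ortholattice
begin

abbreviation neg :: "'a \<Rightarrow> 'a" where
  "neg \<equiv> star imp zero"

lemma neg_closed: "x \<in> X \<Longrightarrow> neg x \<in> X"
  by (simp add: star_def imp_closed zero_closed)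

lemma imp_zero: "imp x zero = neg x"
  by (simp add: star_def)

lemma neg_zero: "neg zero = one"
  by (simp add: star_def imp_self zero_closed)

lemma neg_one: "neg one = zero"
  by (simp add: star_def one_imp zero_closed)

lemma imp_neg_swap:
  assumes "x \<in> X" "y \<in> X"
  shows "imp x (neg y) = imp y (neg x)"
  unfolding star_def using imp_exchange[OF assms zero_closed] .

lemma imp_neg_neg:
  assumes "x \<in> X" "y \<in> X"
  shows "imp (neg x) (neg y) = imp y x"
  using imp_neg_swap[OF neg_closed[OF assms(1)] assms(2)] involutive[OF assms(1)] by simp

lemma neg_imp_swap:
  assumes "x \<in> X" "y \<in> X"
  shows "imp (neg x) y = imp (neg y) x"
  using imp_neg_neg[OF assms(1) neg_closed[OF assms(2)]] involutive[OF assms(2)] by simp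

lemma neg_imp_self:
  assumes "x \<in> X"
  shows "imp (neg x) x = x"
  using implicative[OF assms zero_closed] by (simp add: imp_zero)

lemma imp_neg_self:
  assumes "x \<in> X"
  shows "imp x (neg x) = neg x"
  using neg_imp_self[OF neg_closed[OF assms]] involutive[OF assms] by simp

lemma orth_imp_neg:
  assumes "x \<in> X" "y \<in> X" "orth imp zero x y"
  shows "imp x (neg y) = one"
proof -
  have "neg y = imp y x"
    using orth_sym[OF assms] by (simp add: orth_def)
  then have "imp x (neg y) = imp y (imp x x)"
    using imp_exchange assms(1,2) by simp
  then show ?thesis
    using assms(1,2) by (simp add: imp_self imp_one)
qed

text \<open>
  In lattice terms \<open>x\<close> lies below \<open>y\<^sup>* \<or> x\<close>.  Both directions of the
  equivalence obtain their auxiliary orthogonal elements from this.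
\<close>

lemma orth_neg_imp:
  assumes "x \<in> X" "y \<in> X"
  shows "orth imp zero x (neg (imp y x))"
proof -
  have "imp x (neg (imp y x)) = imp (imp y x) (neg x)"
    using assms by (intro imp_neg_swap imp_closed)
  also have "\<dots> = imp (imp (neg x) (neg y)) (neg x)"
    using assms by (simp add: imp_neg_neg)
  also have "\<dots> = neg x"
    using assms by (intro implicative neg_closed)
  finally show ?thesis
    by (simp add: orth_def)
qed

text \<open>
  Since \<open>imp (neg a) b\<close> is the join of \<open>a\<close> and \<open>b\<close>, the last three conditions say that the join of
  two of the elements is the complement of the third.  Members may be \<open>zero\<close>.
\<close>

definition partition_of_unity :: "'a \<Rightarrow> 'a \<Rightarrow> 'a \<Rightarrow> bool" where
  "partition_of_unity a b c \<longleftrightarrow>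
     a \<in> X \<and> b \<in> X \<and> c \<in> X \<and>
     orth imp zero a b \<and> orth imp zero b c \<and> orth imp zero c a \<and>
     imp (neg a) b = neg c \<and> imp (neg b) c = neg a \<and> imp (neg c) a = neg b"

lemma partition_of_unity_rotate:
  "partition_of_unity a b c \<Longrightarrow> partition_of_unity b c a"
  unfolding partition_of_unity_def by blast

lemma partition_of_unity_swap:
  assumes "partition_of_unity a b c"
  shows "partition_of_unity b a c"
  using assms orth_sym neg_imp_swap unfolding partition_of_unity_def by metis

text \<open>
  The values of \<open>imp\<close> for arguments built from \<open>a\<close> and \<open>b\<close>.  Permuting the three members gives
  all other entries of the truth table, except those involving \<open>zero\<close> or \<open>one\<close> and those where
  both arguments come from the same member.
\<close>

lemma partition_of_unity_table:
  assumes "partition_of_unity a b c"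
  shows "imp a b = neg a" "imp a (neg b) = one" "imp (neg a) b = neg c"
    "imp (neg a) (neg b) = neg b"
proof -
  have X: "a \<in> X" "b \<in> X" and o: "orth imp zero a b"
    and j: "imp (neg a) b = neg c"
    using assms by (auto simp: partition_of_unity_def)
  show "imp a b = neg a"
    using o by (simp add: orth_def)
  show "imp a (neg b) = one"
    by (rule orth_imp_neg[OF X o])
  show "imp (neg a) b = neg c"
    by (rule j)
  show "imp (neg a) (neg b) = neg b"
    using imp_neg_neg[OF X] orth_sym[OF X o] by (simp add: orth_def)
qed

lemma partition_of_unity_boolean_subalgebra:
  assumes abc: "partition_of_unity a b c"
  shows "implicative_boolean_subalgebra
    {zero, one, a, b, c, neg a, neg b, neg c} X imp one zero"
    (is "implicative_boolean_subalgebra ?S _ _ _ _")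
proof -
  have X: "a \<in> X" "b \<in> X" "c \<in> X"
    using abc by (auto simp: partition_of_unity_def)
  have S: "?S \<subseteq> X"
    using X by (auto simp: one_closed zero_closed neg_closed)
  note bca = partition_of_unity_rotate[OF abc]
  note cab = partition_of_unity_rotate[OF bca]
  note table =
    partition_of_unity_table[OF abc] partition_of_unity_table[OF bca]
    partition_of_unity_table[OF cab]
    partition_of_unity_table[OF partition_of_unity_swap[OF abc]]
    partition_of_unity_table[OF partition_of_unity_swap[OF bca]]
    partition_of_unity_table[OF partition_of_unity_swap[OF cab]]
  note diagonal = X[THEN imp_self] X[THEN imp_neg_self] X[THEN neg_imp_self]
    X[THEN neg_closed, THEN imp_self]
  note bounds = X[THEN one_imp] X[THEN neg_closed, THEN one_imp]
    X[THEN imp_one] X[THEN neg_closed, THEN imp_one]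
    X[THEN zero_least] X[THEN neg_closed, THEN zero_least]
    one_closed[THEN imp_self] one_closed[THEN zero_least]
    zero_closed[THEN one_imp] zero_closed[THEN imp_self]
    imp_zero neg_zero neg_one X[THEN involutive]
  have closed: "imp x y \<in> ?S" if "x \<in> ?S" "y \<in> ?S" for x y
    using that by (elim insertE emptyE; simp add: table diagonal bounds)
  have boolean: "imp (imp (neg y) x) y = imp x y" if "x \<in> ?S" "y \<in> ?S" for x y
    using that by (elim insertE emptyE; simp add: table diagonal bounds)
  have "implicative_boolean_algebra ?S imp one zero"
  proof
    show "one \<in> ?S" "zero \<in> ?S"
      by simp_all
    fix x assume x: "x \<in> ?S"
    then have xX: "x \<in> X" using S by blast
    show "imp x x = one" "imp x one = one" "imp one x = x" "imp zero x = one"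
      "neg (neg x) = x"
      using xX by (simp_all add: imp_self imp_one one_imp zero_least involutive)
    fix y assume y: "y \<in> ?S"
    then have yX: "y \<in> X" using S by blast
    show "imp x y \<in> ?S"
      by (rule closed[OF x y])
    show "imp (imp x y) x = x"
      by (rule implicative[OF xX yX])
    show "imp (imp (neg y) x) y = imp x y"
      by (rule boolean[OF x y])
    fix z assume "z \<in> ?S"
    then have "z \<in> X" using S by blast
    then show "imp x (imp y z) = imp y (imp x z)"
      by (rule imp_exchange[OF xX yX])
  qed
  then show ?thesis
    using S by (simp add: implicative_boolean_subalgebra_def)
qed

end

text \<open>
  The complement of the join of \<open>a\<close> and \<open>b\<close> is orthogonal to both in every
  implicative-ortholattice.  Orthomodularity is what makes the remaining two joins large enough:
  for orthogonal \<open>a, b\<close> it gives \<open>(b \<or> a) \<and> a\<^sup>* = b\<close>, and taking complements turns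
  this into \<open>c \<or> a = b\<^sup>*\<close>.
\<close>

lemma (in implicative_orthomodular_lattice) orthogonal_pair_partition_of_unity:
  assumes a: "a \<in> X" and b: "b \<in> X" and o: "orth imp zero a b"
  shows "partition_of_unity a b (neg (imp (neg a) b))"
proof -
  let ?c = "neg (imp (neg a) b)"
  have join_closed: "imp (neg a) b \<in> X"
    using a b by (intro imp_closed neg_closed)
  have c: "?c \<in> X"
    by (rule neg_closed[OF join_closed])
  have nc: "neg ?c = imp (neg a) b"
    by (rule involutive[OF join_closed])
  have bc: "orth imp zero b ?c"
    by (rule orth_neg_imp[OF b neg_closed[OF a]])
  have ac: "orth imp zero a ?c"
    using orth_neg_imp[OF a neg_closed[OF b]] neg_imp_swap[OF a b] by simp
  \<comment> \<open>The complemented orthomodular law \<open>(x \<or> y)\<^sup>* \<or> y = x\<^sup>*\<close>; orthogonality reduces the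
    inner \<open>imp y x\<close> of the axiom to \<open>y\<^sup>*\<close>.\<close>
  have relative: "imp (imp (neg x) y) y = neg x"
    if x: "x \<in> X" and y: "y \<in> X" and yx: "orth imp zero y x" for x y
  proof -
    have "imp y x = neg y"
      using yx by (simp add: orth_def)
    then have "neg (imp (imp (neg x) y) y) = x"
      using orthomodular[OF x y] involutive[OF y] by (simp add: meetQ_def)
    moreover have "imp (imp (neg x) y) y \<in> X"
      using x y by (intro imp_closed neg_closed)
    ultimately show ?thesis
      using involutive by metis
  qed
  have "imp (neg ?c) a = neg b"
    using relative[OF b a o] neg_imp_swap[OF a b] nc by simp
  moreover have "imp (neg b) ?c = neg a"
    using relative[OF a b orth_sym[OF a b o]] neg_imp_swap[OF b c] nc by simp
  ultimately show ?thesis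
    using a b c o bc orth_sym[OF a c ac] nc by (simp add: partition_of_unity_def)
qed

text \<open>
  The orthomodular law at \<open>x, y\<close> follows from the Boolean law for \<open>x\<close> and \<open>w = (imp y x)\<^sup>*\<close>,
  which are always orthogonal.
\<close>

lemma (in implicative_ortholattice) orthomodular_if_orthogonal_pairs_boolean:
  assumes cover: "\<And>a b. \<lbrakk>a \<in> X; b \<in> X; orth imp zero a b\<rbrakk> \<Longrightarrow>
    \<exists>S. implicative_boolean_subalgebra S X imp one zero \<and> a \<in> S \<and> b \<in> S"
  shows "implicative_orthomodular_lattice X imp one zero"
proof
  fix x y
  assume x: "x \<in> X" and y: "y \<in> X"
  let ?w = "neg (imp y x)"
  have w: "?w \<in> X"
    using x y by (intro imp_closed neg_closed)
  have o: "orth imp zero x ?w"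
    by (rule orth_neg_imp[OF x y])
  obtain S where S: "implicative_boolean_algebra S imp one zero" "x \<in> S" "?w \<in> S"
    using cover[OF x w o] by (auto simp: implicative_boolean_subalgebra_def)
  have "imp (imp (neg x) ?w) ?w = imp (imp (neg ?w) x) ?w"
    using neg_imp_swap[OF x w] by simp
  also have "\<dots> = imp x ?w"
    by (rule implicative_boolean_algebra.boolean[OF S])
  also have "\<dots> = neg x"
    using o by (simp add: orth_def)
  finally show "meetQ imp zero x (imp y x) = x"
    using involutive[OF x] by (simp add: meetQ_def)
qed

theorem (in implicative_ortholattice) orthomodular_iff_orthogonal_pairs_boolean:
  "implicative_orthomodular_lattice X imp one zero \<longleftrightarrow>
    (\<forall>a\<in>X. \<forall>b\<in>X. orth imp zero a b \<longrightarrow>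
      (\<exists>S. implicative_boolean_subalgebra S X imp one zero \<and> a \<in> S \<and> b \<in> S))"
    (is "?oml \<longleftrightarrow> ?cover")
proof
  assume oml: ?oml
  show ?cover
  proof (intro ballI impI)
    fix a b
    assume "a \<in> X" "b \<in> X" "orth imp zero a b"
    then have "partition_of_unity a b (neg (imp (neg a) b))"
      by (rule implicative_orthomodular_lattice.orthogonal_pair_partition_of_unity[OF oml])
    from partition_of_unity_boolean_subalgebra[OF this]
    show "\<exists>S. implicative_boolean_subalgebra S X imp one zero \<and> a \<in> S \<and> b \<in> S"
      by blast
  qed
next
  assume ?cover
  then show ?oml
    by (intro orthomodular_if_orthogonal_pairs_boolean) blast
qed

theorem proposition7p2:
  fixes X :: "'a set" and imp :: "'a \<Rightarrow> 'a \<Rightarrow> 'a" and one zero :: 'a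
    and X' :: "'a set" and perp :: "'a \<Rightarrow> 'a \<Rightarrow> bool"
  defines "X' \<equiv> X - {zero}"
    and "perp \<equiv> orth imp zero"
  assumes "implicative_ortholattice X imp one zero"
  shows "dacey_space X' perp \<longleftrightarrow>
    (\<forall>A\<in>CL X' perp. \<forall>B\<in>CL X' perp. orth (CL_imp X' perp) {} A B \<longrightarrow>
      (\<exists>S. implicative_boolean_subalgebra S (CL X' perp) (CL_imp X' perp) X' {} \<and>
        A \<in> S \<and> B \<in> S))"
proof -
  have space: "orthogonality_space X' perp"
    unfolding X'_def perp_def
    by (rule implicative_ortholattice.associated_orthogonality_space[OF assms(3)])
  have "dacey_space X' perp \<longleftrightarrow>
      implicative_orthomodular_lattice (CL X' perp) (CL_imp X' perp) X' {}"
    using space by (simp add: dacey_space_def dacey_space_axioms_def)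
  then show ?thesis
    using implicative_ortholattice.orthomodular_iff_orthogonal_pairs_boolean[
        OF orthogonality_space.CL_implicative_ortholattice[OF space]]
    by simp
qed

end
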